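(* Consider $\beta,\rho\in\mathbb{R}_+$ satisfying $\rho\beta<1$, and let $\Sigma(t)$ and $\bar\Sigma(t)$ be the data correlation matrices defined in the context. Let $(A,B)\in\mathcal{M}_\beta$. Additionally, suppose that $$\left\lVert E^\top\right\rVert_\infty\left\lVert A^\top-\begin{bmatrix}I&0\end{bmatrix}\Sigma^{-1}(t)\bar\Sigma^\top(t)\right\rVert_\infty+\left\lVert B^\top-\begin{bmatrix}0&I\end{bmatrix}\Sigma^{-1}(t)\bar\Sigma^\top(t)\right\rVert_\infty\le\rho\qquad\text{for all }t\ge t_0 .$$ Let $p\in\mathbb{R}^n_+$ be the solution to the model-based algebraic equation $$p=s+A^\top p+\sum_{i=1}^n\min\{r_i+B_i^\top p,0\}E_i ,$$ and let $q(t)$ be the solution of the data-based algebraic equation $$\left(q(t)-\begin{bmatrix}s\\ r\end{bmatrix}\right)^\top\Sigma(t)=\min_{K(t)\in\mathcal{K}(E)}q(t)^\top\begin{bmatrix}I\\ K(t)\end{bmatrix}\bar\Sigma(t)$$ with $K(t)$ being the minimizing argument. Define $p(t)=\begin{bmatrix}I&K^\top(t)\end{bmatrix}q(t)$. Then (for $t\ge t_0$) it holds that $$\hat\alpha\,p\le p(t)\le\check\alpha^{-1}p$$ for positive constants satisfying $\check\alpha=1-\rho\beta$ and $\hat\alpha=1-\check\alpha^{-1}\rho\beta$.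
   Context: All inequalities between vectors or matrices are element-wise. $\lVert\cdot\rVert_\infty$ of a matrix is the induced $\infty$-norm (maximal absolute row sum). $\mathbb{R}^n_+$ is the closed nonnegative orthant and $\mathbf 1$ the all-ones vector. Plant data. $A\in\mathbb{R}^{n\times n}$, $B=[B_1\ \cdots\ B_n]\in\mathbb{R}^{n\times m}$ with $B_i\in\mathbb{R}^{n\times m_i}$, $m=\sum_i m_i$. Costs: $s\in\mathbb{R}^n_+$ and $r\in\mathbb{R}^m_+$, with $r$ partitioned into $r_i\in\mathbb{R}^{m_i}_+$. Constraint matrix $E=[E_1\ \cdots\ E_n]^\top\in\mathbb{R}^{n\times n}_+$ (rows $E_i^\top$, with $E_i\in\mathbb{R}^n_+$); $\bar E\in\mathbb{R}^{m\times n}_+$ is obtained by stacking, for $i=1,\dots,n$, $m_i$ copies of the row $E_i^\top$. The underlying optimal control problem is to minimize $\sum_{t\ge0}[s^\top x(t)+r^\top u(t)]$ subject to $x(t+1)=Ax(t)+Bu(t)$, $x(0)=x_0$, $u(t)\ge0$ and $\mathbf 1^\top u_i(t)\le E_i^\top x(t)$ for $i=1,\dots,n$, where $u$ is partitioned into blocks $u_i\in\mathbb{R}^{m_i}$. For a vector $v$, $\min\{v,0\}$ denotes the scalar equal to the smallest entry of $v$ if that entry is negative, and $0$ otherwise. Feasible gains. $\mathcal{K}(E)$ is the set of $K=[K_1^\top\ \cdots\ K_n^\top]^\top$ with $K_i\in\mathbb{R}^{m_i\times n}_+$ such that for every $i$ either $\mathbf 1^\top K_i=E_i^\top$ or $\mathbf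 1^\top K_i=0$. Assumption 1: $(A+BK)x\ge0$ for all $K\in\mathcal{K}(E)$ and all reachable states $x\in\mathbb{R}^n_+$. Assumption 2: $s>\bar E^\top r$. $\mathcal{M}_\beta$ is the set of plants $(A,B,E)$ satisfying Assumptions 1 and 2 for which the equation $p=s+A^\top p+\sum_{i=1}^n\min\{r_i+B_i^\top p,0\}E_i$ admits a solution $p$ with $s\le p\le(\beta\min_i s_i)\mathbf 1\le\beta s$. Writing $(A,B)\in\mathcal{M}_\beta$ means that $(A,B,E)$ belongs to this set. Data. Sequences $x(k)\in\mathbb{R}^n$, $u(k)\in\mathbb{R}^m$, $w(k)\in\mathbb{R}^n$ satisfy $x(k+1)=Ax(k)+Bu(k)+w(k)$, with no stochastic assumption on the disturbance $w$. For a forgetting factor $\lambda\in(0,1]$ and a matrix $\Sigma(0)\succ0$ of size $(n+m)\times(n+m)$, $$\Sigma(t)=\sum_{k=0}^{t-1}\lambda^{t-1-k}\begin{bmatrix}x(k)\\ u(k)\end{bmatrix}\begin{bmatrix}x(k)\\ u(k)\end{bmatrix}^\top+\lambda^t\Sigma(0),\qquad\bar\Sigma(t)=\sum_{k=0}^{t-1}\lambda^{t-1-k}x(k+1)\begin{bmatrix}x(k)\\ u(k)\end{bmatrix}^\top .$$ Data-based equation. For $q=\begin{bmatrix}q^x\\ q^u\end{bmatrix}$ with $q^x\in\mathbb{R}^n$ and $q^u\in\mathbb{R}^m$ partitioned into $q^u_i\in\mathbb{R}^{m_i}$, the minimizing argument $K\in\mathcal{K}(E)$ is: if $q_i^u$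 has a negative entry, $K_i$ has $E_i^\top$ as its $j$-th row, where $j$ is the index of the most negative entry of $q_i^u$, and zeros elsewhere; otherwise $K_i=0$. A solution is a $q(t)$ satisfying the equation with $K(t)$ the minimizing argument associated with $q(t)$.
   Formalization: In the error bound the factor ‖Eᵀ‖∞ multiplies the B-term, not the A-term (false as printed, e.g. E=0); "the solution" q(t) means one with p(t)≥0, or the only solution when α̂>0 (spurious solutions exist); α̂>0 is asserted exactly when 2ρβ<1. *)

theory Defs
  imports "HOL-Analysis.Analysis"
begin

text \<open>
  The input space is indexed by a finite type \<open>'m\<close> and a map \<open>blk :: 'm \<Rightarrow> 'n\<close> assigns
  every input to its block: \<open>m_i\<close> is the cardinality of \<open>{j. blk j = i}\<close>, and \<open>u_i\<close>, \<open>r_i\<close>,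
  \<open>B_i\<close>, \<open>K_i\<close> consist of the entries, columns or rows with index in that set.
  The vector \<open>E_i\<close> is the row \<open>E $ i\<close>.

  On \<open>real ^ 'n\<close> and on matrices, \<open>\<le>\<close> is the element-wise order. The library's \<open><\<close> is not the
  element-wise strict order, so strict vector inequalities are spelled out.
\<close>

definition vjoin :: "real ^ 'a \<Rightarrow> real ^ 'b \<Rightarrow> real ^ ('a + 'b)" where
  "vjoin x u = (\<chi> k. case k of Inl i \<Rightarrow> x $ i | Inr j \<Rightarrow> u $ j)"

definition vstack :: "real ^ 'c ^ 'a \<Rightarrow> real ^ 'c ^ 'b \<Rightarrow> real ^ 'c ^ ('a + 'b)" where
  "vstack M N = (\<chi> k. case k of Inl i \<Rightarrow> M $ i | Inr j \<Rightarrow> N $ j)"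

definition hstack :: "real ^ 'a ^ 'c \<Rightarrow> real ^ 'b ^ 'c \<Rightarrow> real ^ ('a + 'b) ^ 'c" where
  "hstack M N = (\<chi> i. vjoin (M $ i) (N $ i))"

definition upart :: "real ^ ('a::finite + 'b) \<Rightarrow> real ^ 'b" where
  "upart q = (\<chi> j. q $ Inr j)"

definition outer :: "real ^ 'a \<Rightarrow> real ^ 'b \<Rightarrow> real ^ 'b ^ 'a" where
  "outer x y = (\<chi> i j. x $ i * y $ j)"

definition pos_def :: "real ^ 'a ^ 'a \<Rightarrow> bool" where
  "pos_def S \<longleftrightarrow> transpose S = S \<and> (\<forall>v. v \<noteq> 0 \<longrightarrow> v \<bullet> (S *v v) > 0)"

definition norm_inf :: "real ^ 'a ^ 'b \<Rightarrow> real" where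
  "norm_inf M = Max (range (\<lambda>i. \<Sum>j\<in>UNIV. \<bar>M $ i $ j\<bar>))"

text \<open>The scalar \<open>min {v_i, 0}\<close> for the block \<open>v_i\<close> of \<open>v\<close>.\<close>

definition neg_min :: "('m \<Rightarrow> 'n) \<Rightarrow> real ^ 'm \<Rightarrow> 'n \<Rightarrow> real" where
  "neg_min blk v i =
     (if \<exists>j. blk j = i \<and> v $ j < 0 then Min {v $ j | j. blk j = i} else 0)"

definition feasible_gains :: "('m \<Rightarrow> 'n) \<Rightarrow> real ^ 'n ^ 'n \<Rightarrow> (real ^ 'n ^ 'm) set" where
  "feasible_gains blk E =
     {K. 0 \<le> K \<and> (\<forall>i. (\<Sum>j | blk j = i. K $ j) = E $ i \<or> (\<Sum>j | blk j = i. K $ j) = 0)}"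

definition E_bar :: "('m \<Rightarrow> 'n) \<Rightarrow> real ^ 'n ^ 'n \<Rightarrow> real ^ 'n ^ 'm" where
  "E_bar blk E = (\<chi> j. E $ blk j)"

text \<open>States reachable from some initial state in the nonnegative orthant by admissible inputs.\<close>

inductive reachable ::
  "('m \<Rightarrow> 'n) \<Rightarrow> real ^ 'n ^ 'n \<Rightarrow> real ^ 'm ^ 'n \<Rightarrow> real ^ 'n ^ 'n \<Rightarrow> real ^ 'n \<Rightarrow> bool"
  for blk A B E where
  init: "0 \<le> x0 \<Longrightarrow> reachable blk A B E x0"
| step: "reachable blk A B E x \<Longrightarrow> 0 \<le> u \<Longrightarrow> (\<And>i. (\<Sum>j | blk j = i. u $ j) \<le> (E $ i) \<bullet> x)
          \<Longrightarrow> reachable blk A B E (A *v x + B *v u)"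

definition positivity_assumption ::
  "('m \<Rightarrow> 'n) \<Rightarrow> real ^ 'n ^ 'n \<Rightarrow> real ^ 'm ^ 'n \<Rightarrow> real ^ 'n ^ 'n \<Rightarrow> bool" where
  "positivity_assumption blk A B E \<longleftrightarrow>
     (\<forall>K \<in> feasible_gains blk E. \<forall>x. reachable blk A B E x \<and> 0 \<le> x \<longrightarrow> 0 \<le> (A + B ** K) *v x)"

definition cost_assumption ::
  "('m \<Rightarrow> 'n) \<Rightarrow> real ^ 'n \<Rightarrow> real ^ 'm \<Rightarrow> real ^ 'n ^ 'n \<Rightarrow> bool" where
  "cost_assumption blk s r E \<longleftrightarrow> (\<forall>i. s $ i > (transpose (E_bar blk E) *v r) $ i)"

definition model_solution ::
  "('m \<Rightarrow> 'n) \<Rightarrow> real ^ 'n \<Rightarrow> real ^ 'm \<Rightarrow> real ^ 'n ^ 'n \<Rightarrow> real ^ 'm ^ 'n \<Rightarrow> real ^ 'n ^ 'n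
     \<Rightarrow> real ^ 'n \<Rightarrow> bool" where
  "model_solution blk s r A B E p \<longleftrightarrow>
     p = s + transpose A *v p
           + (\<Sum>i\<in>UNIV. neg_min blk (r + transpose B *v p) i *\<^sub>R (E $ i))"

definition plant_class ::
  "('m \<Rightarrow> 'n) \<Rightarrow> real ^ 'n \<Rightarrow> real ^ 'm \<Rightarrow> real
     \<Rightarrow> ((real ^ 'n ^ 'n) \<times> (real ^ 'm ^ 'n) \<times> (real ^ 'n ^ 'n)) set" where
  "plant_class blk s r \<beta> =
     {(A, B, E). positivity_assumption blk A B E \<and> cost_assumption blk s r E \<and>
        (\<exists>p. model_solution blk s r A B E p \<and> s \<le> p \<and>
             p \<le> (\<beta> * Min (range (($) s))) *\<^sub>R 1 \<and>
             (\<beta> * Min (range (($) s))) *\<^sub>R 1 \<le> \<beta> *\<^sub>R s)}"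

definition Sigma_mat ::
  "real \<Rightarrow> real ^ ('n + 'm) ^ ('n + 'm) \<Rightarrow> (nat \<Rightarrow> real ^ 'n) \<Rightarrow> (nat \<Rightarrow> real ^ 'm)
     \<Rightarrow> nat \<Rightarrow> real ^ ('n + 'm) ^ ('n + 'm)" where
  "Sigma_mat l S0 x u t =
     (\<Sum>k<t. l ^ (t - 1 - k) *\<^sub>R outer (vjoin (x k) (u k)) (vjoin (x k) (u k))) + l ^ t *\<^sub>R S0"

definition Sigma_bar ::
  "real \<Rightarrow> (nat \<Rightarrow> real ^ 'n) \<Rightarrow> (nat \<Rightarrow> real ^ 'm) \<Rightarrow> nat \<Rightarrow> real ^ ('n + 'm) ^ 'n" where
  "Sigma_bar l x u t =
     (\<Sum>k<t. l ^ (t - 1 - k) *\<^sub>R outer (x (k + 1)) (vjoin (x k) (u k)))"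

text \<open>
  The gain minimizing \<open>q\<^sup>T [I; K]\<close> over the feasible gains: a block of \<open>q\<^sup>u\<close> with a negative
  entry gets \<open>E_i\<close> in a row where \<open>q\<^sup>u_i\<close> is smallest (any such row, in case of ties).
\<close>

definition min_gain ::
  "('m \<Rightarrow> 'n) \<Rightarrow> real ^ 'n ^ 'n \<Rightarrow> real ^ ('n + 'm) \<Rightarrow> real ^ 'n ^ 'm \<Rightarrow> bool" where
  "min_gain blk E q K \<longleftrightarrow>
     K \<in> feasible_gains blk E \<and>
     (\<forall>i. if \<exists>j. blk j = i \<and> upart q $ j < 0
          then \<exists>j. blk j = i \<and> (\<forall>l. blk l = i \<longrightarrow> upart q $ j \<le> upart q $ l) \<and>
                   K $ j = E $ i \<and> (\<forall>l. blk l = i \<and> l \<noteq> j \<longrightarrow> K $ l = 0)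
          else \<forall>j. blk j = i \<longrightarrow> K $ j = 0)"

definition data_solution ::
  "('m \<Rightarrow> 'n) \<Rightarrow> real ^ 'n \<Rightarrow> real ^ 'm \<Rightarrow> real ^ 'n ^ 'n \<Rightarrow> real ^ ('n + 'm) ^ ('n + 'm)
     \<Rightarrow> real ^ ('n + 'm) ^ 'n \<Rightarrow> real ^ ('n + 'm) \<Rightarrow> real ^ 'n ^ 'm \<Rightarrow> bool" where
  "data_solution blk s r E S Sb q K \<longleftrightarrow>
     min_gain blk E q K \<and>
     (q - vjoin s r) v* S = q v* vstack (mat 1) K v* Sb"

end

theory Submission
  imports Defs
begin

text \<open>
  Eliminating \<open>q\<close> from the data-based equation by inverting the positive definite \<open>\<Sigma>(t)\<close> leaves
  a fixed-point equation for \<open>p(t)\<close> alone, and this is the model-based equation with \<open>A\<close>, \<open>B\<close>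
  replaced by the least-squares estimates \<open>A_est\<close>, \<open>B_est\<close> that occur in the error bound. So the
  theorem compares fixed points of two operators: \<open>F = bellman blk s r A B E\<close> with fixed point
  \<open>p\<close>, and \<open>G\<close>, the same operator for the estimates, with fixed point \<open>p(t)\<close>. On vectors with
  entries of modulus at most \<open>d\<close> the two differ by at most \<open>\<rho> * d\<close> in every entry
  (\<open>bellman_diff_le\<close>).

  Only \<open>F\<close> comes from a plant with \<open>A + BK \<ge> 0\<close>, so only \<open>F\<close> has good order properties. As a
  minimum over gains of the affine maps \<open>s + K\<^sup>T r + (A + BK)\<^sup>T v\<close>, it is monotone and concave,
  and \<open>F 0 \<ge> s\<close>; hence \<open>\<theta> F v + (1 - \<theta>) s \<le> F (\<theta> v)\<close> for \<open>\<theta>\<close> in the unit interval.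
  The bounds follow from a touching argument. Take the least \<open>\<theta>\<close> with \<open>p(t) \<le> \<theta> p\<close>, so that
  equality holds in some entry \<open>i\<close>. If \<open>\<theta> > 1\<close>, then monotonicity and concavity make \<open>F (p(t))\<close> lie
  below \<open>\<theta> p\<close> by at least \<open>(\<theta> - 1) s\<close>, whereas passing to \<open>G\<close> costs at most \<open>\<theta> \<rho> \<beta> s\<close>,
  because \<open>p \<le> \<beta> min s\<close>. Entry \<open>i\<close> then forces \<open>\<theta> - 1 \<le> \<theta> \<rho> \<beta>\<close>. The
  lower bound is the mirror image and uses the upper one to bound the size of \<open>p(t)\<close>. With
  \<open>G = F\<close> and no error the same argument gives uniqueness of nonnegative fixed points of \<open>F\<close>, so
  that the bound \<open>\<beta> min s\<close>, which the plant class grants for some solution, holds for \<open>p\<close>.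

  The touching argument needs \<open>p(t) \<ge> 0\<close>. Where this is not given, \<open>q(t)\<close> is the
  only solution of the data-based equation and \<open>\<alpha>_hat > 0\<close>. By the estimates above,
  \<open>G\<close> maps the order interval between \<open>\<alpha>_hat p\<close> and \<open>p / \<alpha>_check\<close> into itself, and Brouwer's
  theorem gives a fixed point there. It belongs to a solution of the data-based equation, which by
  uniqueness is \<open>q(t)\<close>; and \<open>p(t)\<close> depends on \<open>q(t)\<close> but not on how ties in \<open>K(t)\<close> are broken.
\<close>

section \<open>Perturbed fixed points of monotone subhomogeneous maps\<close>

text \<open>
  The last assumption is concavity along rays together with \<open>s \<le> F 0\<close>, which is its case
  \<open>\<theta> = 0\<close>. The vector \<open>s\<close> measures how strictly \<open>F\<close> is subhomogeneous, and this slack is what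
  absorbs perturbations.
\<close>

locale subhomogeneous_map =
  fixes F :: "real ^ 'n \<Rightarrow> real ^ 'n" and s :: "real ^ 'n"
  assumes s_pos: "\<And>i. 0 < s $ i"
    and mono: "\<And>v w. 0 \<le> v \<Longrightarrow> v \<le> w \<Longrightarrow> F v \<le> F w"
    and subhom: "\<And>v \<theta>. 0 \<le> v \<Longrightarrow> 0 \<le> \<theta> \<Longrightarrow> \<theta> \<le> 1 \<Longrightarrow> \<theta> *\<^sub>R F v + (1 - \<theta>) *\<^sub>R s \<le> F (\<theta> *\<^sub>R v)"
begin

lemma fixed_point_ge_s:
  assumes "0 \<le> p" "F p = p"
  shows "s \<le> p"
proof -
  have "s \<le> F 0" using subhom[of 0 0] by simp
  also have "\<dots> \<le> F p" using mono assms(1) by simp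
  finally show ?thesis using assms(2) by simp
qed

text \<open>
  Subhomogeneity read backwards: shrink \<open>\<theta> v\<close> by the factor \<open>1 / \<theta>\<close>.
\<close>

lemma stretch_le:
  assumes "0 \<le> v" "1 \<le> \<theta>"
  shows "F (\<theta> *\<^sub>R v) $ i \<le> \<theta> * F v $ i - (\<theta> - 1) * s $ i"
proof -
  have "0 \<le> \<theta> *\<^sub>R v" using assms by (simp add: less_eq_vec_def)
  from subhom[OF this, of "inverse \<theta>"] assms
  have "inverse \<theta> * F (\<theta> *\<^sub>R v) $ i + (1 - inverse \<theta>) * s $ i \<le> F v $ i"
    by (simp add: less_eq_vec_def field_simps)
  then have "\<theta> * (inverse \<theta> * F (\<theta> *\<^sub>R v) $ i + (1 - inverse \<theta>) * s $ i) \<le> \<theta> * F v $ i"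
    using assms by (intro mult_left_mono) auto
  moreover have "\<theta> * inverse \<theta> = 1" using assms(2) by simp
  ultimately show ?thesis by (simp add: algebra_simps flip: mult.assoc)
qed

end

lemma touching_scale:
  fixes v p :: "real ^ 'n"
  assumes "\<And>i. 0 < p $ i"
  obtains \<theta> i where "v $ i = \<theta> * p $ i" "v \<le> \<theta> *\<^sub>R p"
proof -
  define \<theta> where "\<theta> = Max (range (\<lambda>i. v $ i / p $ i))"
  have "\<theta> \<in> range (\<lambda>i. v $ i / p $ i)" unfolding \<theta>_def by (rule Max_in) auto
  then obtain i where "\<theta> = v $ i / p $ i" by blast
  then have "v $ i = \<theta> * p $ i" using assms[of i] by simp
  moreover have "v $ j \<le> \<theta> * p $ j" for j
  proof -
    have "v $ j / p $ j \<le> \<theta>" unfolding \<theta>_def by (rule Max_ge) auto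
    then show ?thesis using assms[of j] by (simp add: field_simps)
  qed
  ultimately show ?thesis by (intro that) (auto simp: less_eq_vec_def)
qed

text \<open>
  The map \<open>G\<close> is close to \<open>F\<close> but need be neither monotone nor subhomogeneous. The constant
  \<open>\<gamma>\<close> is the size of the perturbation at the scale of \<open>p\<close>, relative to the slack \<open>s\<close>; in the
  application it is \<open>\<rho> \<beta>\<close>.
\<close>

locale perturbed_fixed_point = subhomogeneous_map F s
  for F :: "real ^ 'n \<Rightarrow> real ^ 'n" and s +
  fixes G :: "real ^ 'n \<Rightarrow> real ^ 'n" and p :: "real ^ 'n" and \<rho> c \<gamma> :: real
  assumes p_nonneg: "0 \<le> p" and p_fixed: "F p = p"
    and perturb: "\<And>v d i. 0 \<le> v \<Longrightarrow> (\<And>j. v $ j \<le> d) \<Longrightarrow> \<bar>G v $ i - F v $ i\<bar> \<le> \<rho> * d"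
    and \<rho>_nonneg: "0 \<le> \<rho>" and p_le: "\<And>i. p $ i \<le> c"
    and \<rho>_c_le: "\<And>i. \<rho> * c \<le> \<gamma> * s $ i" and \<gamma>_less_1: "\<gamma> < 1"
begin

lemma p_pos: "0 < p $ i"
  using fixed_point_ge_s[OF p_nonneg p_fixed] s_pos[of i]
  by (auto simp: less_eq_vec_def intro: less_le_trans)

lemma \<gamma>_nonneg: "0 \<le> \<gamma>"
proof -
  fix i :: 'n
  have "0 \<le> \<rho> * c" using \<rho>_nonneg p_pos[of i] p_le[of i] by simp
  also have "\<dots> \<le> \<gamma> * s $ i" by (rule \<rho>_c_le)
  finally show ?thesis using s_pos[of i] by (simp add: zero_le_mult_iff)
qed

lemma one_le_stretch: "1 \<le> inverse (1 - \<gamma>)"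
  using \<gamma>_nonneg \<gamma>_less_1 by (simp add: one_le_inverse_iff)

lemma stretch_eq: "inverse (1 - \<gamma>) - 1 = inverse (1 - \<gamma>) * \<gamma>"
  using \<gamma>_less_1 by (simp add: field_simps)

lemma perturb_below_scaled:
  assumes "0 \<le> v" "v \<le> \<theta> *\<^sub>R p" "0 \<le> \<theta>"
  shows "\<bar>G v $ i - F v $ i\<bar> \<le> \<theta> * \<gamma> * s $ i"
proof -
  have "v $ j \<le> \<theta> * c" for j
    using assms(2) mult_left_mono[OF p_le[of j] assms(3)]
    by (auto simp: less_eq_vec_def intro: order_trans)
  from perturb[OF assms(1) this] have "\<bar>G v $ i - F v $ i\<bar> \<le> \<rho> * (\<theta> * c)" .
  also have "\<dots> = \<theta> * (\<rho> * c)" by simp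
  also have "\<dots> \<le> \<theta> * (\<gamma> * s $ i)" by (intro mult_left_mono \<rho>_c_le assms(3))
  finally show ?thesis by (simp add: mult.assoc)
qed

text \<open>
  Let \<open>\<theta> p\<close> touch \<open>v\<close> from above in entry \<open>i\<close>. If \<open>\<theta> > 1\<close>, then
  \<open>\<theta> p\<^sub>i = G v\<^sub>i \<le> F (\<theta> p)\<^sub>i + \<theta> \<gamma> s\<^sub>i \<le> \<theta> p\<^sub>i - (\<theta> - 1) s\<^sub>i + \<theta> \<gamma> s\<^sub>i\<close>.
\<close>

lemma perturbed_fixed_point_le:
  assumes "0 \<le> v" "G v = v"
  shows "v \<le> inverse (1 - \<gamma>) *\<^sub>R p"
proof -
  obtain \<theta> i where touch: "v $ i = \<theta> * p $ i" and le: "v \<le> \<theta> *\<^sub>R p"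
    using touching_scale p_pos by blast
  have \<theta>: "0 \<le> \<theta>"
    using assms(1) touch p_pos[of i] by (auto simp: less_eq_vec_def zero_le_mult_iff dest: spec[of _ i])
  have "\<theta> \<le> inverse (1 - \<gamma>)"
  proof (cases "\<theta> \<le> 1")
    case True
    then show ?thesis using one_le_stretch by linarith
  next
    case False
    have "\<theta> * p $ i = G v $ i" using touch assms(2) by simp
    also have "\<dots> \<le> F v $ i + \<theta> * \<gamma> * s $ i"
      using perturb_below_scaled[OF assms(1) le \<theta>, of i] by linarith
    also have "F v $ i \<le> F (\<theta> *\<^sub>R p) $ i"
      using mono[OF assms(1) le] by (simp add: less_eq_vec_def)
    also have "\<dots> \<le> \<theta> * p $ i - (\<theta> - 1) * s $ i"
      using stretch_le[OF p_nonneg, of \<theta> i] False p_fixed by simp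
    finally have "(\<theta> * (1 - \<gamma>)) * s $ i \<le> 1 * s $ i" by (simp add: algebra_simps)
    then have "\<theta> * (1 - \<gamma>) \<le> 1" using s_pos[of i] by (rule mult_right_le_imp_le)
    then show ?thesis using \<gamma>_less_1 by (simp add: field_simps)
  qed
  then have "\<theta> *\<^sub>R p \<le> inverse (1 - \<gamma>) *\<^sub>R p"
    using p_nonneg by (simp add: scaleR_right_mono)
  with le show ?thesis by (rule order_trans)
qed

text \<open>
  Now \<open>\<theta> p\<close> touches \<open>v\<close> from below. The perturbation at \<open>v\<close> is controlled by the upper bound
  on \<open>v\<close>, hence the extra factor \<open>inverse (1 - \<gamma>)\<close>.
\<close>

lemma perturbed_fixed_point_ge:
  assumes "0 \<le> v" "G v = v"
  shows "(1 - inverse (1 - \<gamma>) * \<gamma>) *\<^sub>R p \<le> v"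
proof -
  \<comment> \<open>Touching from below is touching from above for \<open>- v\<close>, with scale \<open>- \<theta>\<close>.\<close>
  obtain \<eta> i where "(- v) $ i = \<eta> * p $ i" "- v \<le> \<eta> *\<^sub>R p"
    using touching_scale p_pos by blast
  then obtain \<theta> where touch: "v $ i = \<theta> * p $ i" and le: "\<theta> *\<^sub>R p \<le> v"
    by (auto intro!: that[of "- \<eta>"] simp: minus_le_iff)
  have \<theta>: "0 \<le> \<theta>"
    using assms(1) touch p_pos[of i] by (auto simp: less_eq_vec_def zero_le_mult_iff dest: spec[of _ i])
  have "1 - inverse (1 - \<gamma>) * \<gamma> \<le> \<theta>"
  proof (cases "1 \<le> \<theta>")
    case True
    moreover have "0 \<le> inverse (1 - \<gamma>) * \<gamma>" using \<gamma>_nonneg one_le_stretch by (intro mult_nonneg_nonneg) linarith+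
    ultimately show ?thesis by linarith
  next
    case False
    have "\<theta> * p $ i + (1 - \<theta>) * s $ i \<le> F (\<theta> *\<^sub>R p) $ i"
      using subhom[OF p_nonneg \<theta>] False p_fixed by (simp add: less_eq_vec_def)
    also have "\<dots> \<le> F v $ i"
      using mono[OF _ le] \<theta> p_nonneg by (simp add: less_eq_vec_def)
    also have "\<dots> \<le> G v $ i + inverse (1 - \<gamma>) * \<gamma> * s $ i"
      using perturb_below_scaled[OF assms(1) perturbed_fixed_point_le[OF assms], of i]
        one_le_stretch by linarith
    also have "G v $ i = \<theta> * p $ i" using touch assms(2) by simp
    finally have "(1 - \<theta>) * s $ i \<le> (inverse (1 - \<gamma>) * \<gamma>) * s $ i" by simp
    then have "1 - \<theta> \<le> inverse (1 - \<gamma>) * \<gamma>" using s_pos[of i] by (rule mult_right_le_imp_le)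
    then show ?thesis by linarith
  qed
  then have "(1 - inverse (1 - \<gamma>) * \<gamma>) *\<^sub>R p \<le> \<theta> *\<^sub>R p"
    using p_nonneg by (simp add: scaleR_right_mono)
  then show ?thesis using le by (rule order_trans)
qed

text \<open>
  The factors \<open>a\<close> and \<open>b\<close> of the two preceding bounds satisfy \<open>b - 1 = b \<gamma> = 1 - a\<close>. So at both
  ends of the order interval from \<open>a p\<close> to \<open>b p\<close> the slack guaranteed for \<open>F\<close> equals the bound
  \<open>b \<gamma> s\<close> on the perturbation inside it, and \<open>G\<close> maps the interval into itself.
\<close>

lemma perturbed_fixed_point_exists:
  assumes "continuous_on UNIV G" "0 \<le> 1 - inverse (1 - \<gamma>) * \<gamma>"
  obtains v where "0 \<le> v" "G v = v"
proof -
  define a where "a = 1 - inverse (1 - \<gamma>) * \<gamma>"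
  define b where "b = inverse (1 - \<gamma>)"
  have ab: "0 \<le> a" "a \<le> 1" "1 \<le> b" "b - 1 = b * \<gamma>" "1 - a = b * \<gamma>"
    using assms(2) one_le_stretch stretch_eq \<gamma>_nonneg by (auto simp: a_def b_def)
  let ?S = "{a *\<^sub>R p .. b *\<^sub>R p}"
  have nonneg: "0 \<le> v" if "v \<in> ?S" for v
    using that p_nonneg ab(1) scaleR_nonneg_nonneg[of a p] order_trans by auto
  have "G v \<in> ?S" if "v \<in> ?S" for v
  proof -
    have v: "0 \<le> v" "a *\<^sub>R p \<le> v" "v \<le> b *\<^sub>R p" using nonneg that by auto
    have ap: "0 \<le> a *\<^sub>R p" using p_nonneg ab(1) by (simp add: scaleR_nonneg_nonneg)
    have G: "\<bar>G v $ i - F v $ i\<bar> \<le> b * \<gamma> * s $ i" for i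
      using perturb_below_scaled[OF v(1,3)] ab by simp
    have "G v $ i \<le> b * p $ i" for i
    proof -
      have "F v $ i \<le> F (b *\<^sub>R p) $ i" using mono[OF v(1,3)] by (simp add: less_eq_vec_def)
      also have "\<dots> \<le> b * p $ i - b * \<gamma> * s $ i"
        using stretch_le[OF p_nonneg ab(3), of i] ab(4) p_fixed by simp
      finally show ?thesis using G[of i] by linarith
    qed
    moreover have "a * p $ i \<le> G v $ i" for i
    proof -
      have "a * p $ i + b * \<gamma> * s $ i \<le> F (a *\<^sub>R p) $ i"
        using subhom[OF p_nonneg ab(1,2)] ab(5) p_fixed by (simp add: less_eq_vec_def)
      also have "\<dots> \<le> F v $ i" using mono[OF ap v(2)] by (simp add: less_eq_vec_def)
      finally show ?thesis using G[of i] by linarith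
    qed
    ultimately show ?thesis by (simp add: less_eq_vec_def)
  qed
  moreover have "p \<in> ?S"
    using ab scaleR_right_mono[OF _ p_nonneg, of a 1] scaleR_right_mono[OF _ p_nonneg, of 1 b]
    by simp
  moreover have "compact ?S" "convex ?S" 
    by (auto simp: interval_cbox[symmetric])
  moreover have "continuous_on ?S G" using assms(1) continuous_on_subset by blast
  ultimately obtain v where "v \<in> ?S" "G v = v"
    using brouwer[of ?S G] by (metis (no_types, lifting) empty_iff Pi_I)
  then show ?thesis using nonneg that by blast
qed

end

text \<open>
  The upper bound for \<open>G = F\<close> with zero error. Exchanging \<open>p\<close> and \<open>v\<close> shows that nonnegative
  fixed points of \<open>F\<close> are unique.
\<close>

lemma (in subhomogeneous_map) nonneg_fixed_points_le:
  assumes "0 \<le> p" "F p = p" "0 \<le> v" "F v = v"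
  shows "v \<le> p"
proof -
  interpret perturbed_fixed_point F s F p 0 "Max (range (($) p))" 0
    using assms by unfold_locales (auto intro: Max_ge)
  show ?thesis using perturbed_fixed_point_le[OF assms(3,4)] by simp
qed

section \<open>The switching term and its minimizing gain\<close>

lemma neg_min_nonpos: "neg_min blk v i \<le> 0" for blk :: "'m::finite \<Rightarrow> 'n"
proof (cases "\<exists>j. blk j = i \<and> v $ j < 0")
  case True
  then obtain j where j: "blk j = i" "v $ j < 0" by blast
  have "Min {v $ j | j. blk j = i} \<le> v $ j" using j by (intro Min_le) auto
  with True j show ?thesis by (simp add: neg_min_def)
next
  case False
  then show ?thesis unfolding neg_min_def by (simp only: if_False)
qed

lemma neg_min_le: "blk j = i \<Longrightarrow> neg_min blk v i \<le> v $ j" for blk :: "'m::finite \<Rightarrow> 'n"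
  by (auto simp: neg_min_def not_less intro!: Min_le)

text \<open>
  With the two preceding lemmas: \<open>neg_min blk v i\<close> is the greatest lower bound of \<open>0\<close> and the
  entries of the block, which for an empty block is \<open>0\<close>.
\<close>

lemma neg_min_greatest:
  fixes blk :: "'m::finite \<Rightarrow> 'n"
  assumes "c \<le> 0" "\<And>j. blk j = i \<Longrightarrow> c \<le> v $ j"
  shows "c \<le> neg_min blk v i"
proof (cases "\<exists>j. blk j = i \<and> v $ j < 0")
  case True
  then have "c \<le> Min {v $ j | j. blk j = i}" using assms(2) by (subst Min_ge_iff) auto
  with True show ?thesis by (simp add: neg_min_def)
next
  case False
  with assms(1) show ?thesis unfolding neg_min_def by (simp only: if_False)
qed

lemma neg_min_diff_le:
  fixes blk :: "'m::finite \<Rightarrow> 'n"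
  assumes "0 \<le> d" "\<And>j. \<bar>v $ j - w $ j\<bar> \<le> d"
  shows "\<bar>neg_min blk v i - neg_min blk w i\<bar> \<le> d"
proof -
  have "neg_min blk v i - d \<le> neg_min blk w i" if "\<And>j. \<bar>v $ j - w $ j\<bar> \<le> d" for v w :: "real ^ 'm"
  proof (rule neg_min_greatest)
    show "neg_min blk v i - d \<le> 0" using neg_min_nonpos[of blk v i] assms(1) by linarith
    show "neg_min blk v i - d \<le> w $ j" if "blk j = i" for j
      using neg_min_le[of blk j i v] that \<open>\<And>j. \<bar>v $ j - w $ j\<bar> \<le> d\<close>[of j] by linarith
  qed
  from this[of v w] this[of w v] assms(2) show ?thesis
    by (simp add: abs_le_iff abs_minus_commute)
qed

lemma continuous_on_neg_min: "continuous_on UNIV (\<lambda>v. neg_min blk v i)"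
  for blk :: "'m::finite \<Rightarrow> 'n"
proof (rule lipschitz_on_continuous_on)
  show "1-lipschitz_on UNIV (\<lambda>v. neg_min blk v i)"
  proof (rule lipschitz_onI)
    fix v w :: "real ^ 'm"
    have "\<bar>neg_min blk v i - neg_min blk w i\<bar> \<le> dist v w"
      by (rule neg_min_diff_le) (auto simp: dist_norm component_le_norm_cart simp flip: vector_minus_component)
    then show "dist (neg_min blk v i) (neg_min blk w i) \<le> 1 * dist v w" by (simp add: dist_real_def)
  qed simp
qed

text \<open>
  For \<open>0 \<le> E\<close>, the minimum of \<open>z v* K\<close> over the feasible gains \<open>K\<close>. It is attained in all entries
  simultaneously, because the gain enters block by block and each block of \<open>K\<close> has column sums
  \<open>E $ i\<close> or \<open>0\<close>.
\<close>

definition input_term :: "('m::finite \<Rightarrow> 'n::finite) \<Rightarrow> real ^ 'n ^ 'n \<Rightarrow> real ^ 'm \<Rightarrow> real ^ 'n" where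
  "input_term blk E z = (\<Sum>i\<in>UNIV. neg_min blk z i *\<^sub>R (E $ i))"

lemma vector_gain_mult_blocks:
  fixes blk :: "'m::finite \<Rightarrow> 'n::finite" and z :: "real ^ 'm"
  shows "(z v* K) $ k = (\<Sum>i\<in>UNIV. \<Sum>j | blk j = i. K $ j $ k * z $ j)"
proof -
  have "(\<Sum>i\<in>UNIV. \<Sum>j | blk j = i. K $ j $ k * z $ j) = (\<Sum>j\<in>UNIV. K $ j $ k * z $ j)"
    using sum.group[of UNIV UNIV blk "\<lambda>j. K $ j $ k * z $ j"] by simp
  then show ?thesis by (simp add: vector_matrix_mult_def mult.commute[of "z $ _"])
qed

lemma input_term_le_gain:
  fixes blk :: "'m::finite \<Rightarrow> 'n::finite"
  assumes "K \<in> feasible_gains blk E" "0 \<le> E"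
  shows "input_term blk E z \<le> z v* K"
proof -
  have "neg_min blk z i * E $ i $ k \<le> (\<Sum>j | blk j = i. K $ j $ k * z $ j)" for i k
  proof -
    let ?m = "neg_min blk z i"
    have "(\<Sum>j | blk j = i. K $ j $ k) = (\<Sum>j | blk j = i. K $ j) $ k" by simp
    also have "\<dots> = E $ i $ k \<or> \<dots> = 0"
      using assms(1) unfolding feasible_gains_def mem_Collect_eq by (metis zero_index)
    finally have "(\<Sum>j | blk j = i. K $ j $ k) = E $ i $ k \<or> (\<Sum>j | blk j = i. K $ j $ k) = 0" .
    moreover have "0 \<le> E $ i $ k" using assms(2) by (simp add: less_eq_vec_def)
    ultimately have "?m * E $ i $ k \<le> ?m * (\<Sum>j | blk j = i. K $ j $ k)"
      using neg_min_nonpos[of blk z i] by (auto simp: mult_nonpos_nonneg)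
    also have "\<dots> = (\<Sum>j | blk j = i. K $ j $ k * ?m)" by (simp add: sum_distrib_left mult.commute)
    also have "\<dots> \<le> (\<Sum>j | blk j = i. K $ j $ k * z $ j)"
      using assms(1) unfolding feasible_gains_def
      by (intro sum_mono mult_left_mono neg_min_le) (auto simp: less_eq_vec_def)
    finally show ?thesis .
  qed
  then show ?thesis
    by (auto simp: less_eq_vec_def input_term_def vector_gain_mult_blocks[of _ _ _ blk] intro!: sum_mono)
qed

lemma input_term_eq_min_gain:
  fixes blk :: "'m::finite \<Rightarrow> 'n::finite"
  assumes "min_gain blk E q K"
  shows "upart q v* K = input_term blk E (upart q)"
proof -
  let ?z = "upart q"
  note gain = assms[unfolded min_gain_def, THEN conjunct2, THEN spec]
  have "(\<Sum>j | blk j = i. K $ j $ k * ?z $ j) = neg_min blk ?z i * E $ i $ k" for i k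
  proof (cases "\<exists>j. blk j = i \<and> ?z $ j < 0")
    case True
    obtain j where j: "blk j = i" "\<And>l. blk l = i \<Longrightarrow> ?z $ j \<le> ?z $ l"
      "K $ j = E $ i" "\<And>l. blk l = i \<Longrightarrow> l \<noteq> j \<Longrightarrow> K $ l = 0"
      using gain[of i] unfolding if_P[OF True] by blast
    have "(\<Sum>l | blk l = i. K $ l $ k * ?z $ l) = (\<Sum>l\<in>{j}. K $ l $ k * ?z $ l)"
      by (rule sum.mono_neutral_right) (use j in auto)
    moreover have "neg_min blk ?z i = ?z $ j"
    proof -
      have "Min {?z $ j | j. blk j = i} = ?z $ j" by (rule Min_eqI) (use j in auto)
      then show ?thesis using True by (simp add: neg_min_def)
    qed
    ultimately show ?thesis using j by simp
  next
    case False
    have "\<forall>j. blk j = i \<longrightarrow> K $ j = 0" using gain[of i] unfolding if_not_P[OF False] .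
    moreover have "neg_min blk ?z i = 0" using False unfolding neg_min_def by (simp only: if_False)
    ultimately show ?thesis by simp
  qed
  then show ?thesis by (simp add: vec_eq_iff input_term_def vector_gain_mult_blocks[of _ _ _ blk])
qed

lemma min_gain_exists:
  fixes blk :: "'m::finite \<Rightarrow> 'n::finite"
  assumes "0 \<le> E"
  obtains K where "min_gain blk E q K"
proof -
  let ?z = "upart q"
  define act where "act i \<longleftrightarrow> (\<exists>j. blk j = i \<and> ?z $ j < 0)" for i
  define J where "J i = (ARG_MIN (\<lambda>j. ?z $ j) j. blk j = i)" for i
  have J: "blk (J i) = i" "\<And>l. blk l = i \<Longrightarrow> ?z $ J i \<le> ?z $ l" if "act i" for i
  proof -
    have "finite {j. blk j = i}" "{j. blk j = i} \<noteq> {}" using that by (auto simp: act_def)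
    then have "is_arg_min (\<lambda>j. ?z $ j) (\<lambda>j. blk j = i) (J i)"
      unfolding J_def using ex_is_arg_min_if_finite[of "{j. blk j = i}" "\<lambda>j. ?z $ j"]
      by (auto simp: arg_min_def intro: someI_ex)
    then show "blk (J i) = i" "\<And>l. blk l = i \<Longrightarrow> ?z $ J i \<le> ?z $ l"
      by (auto simp: is_arg_min_def not_less)
  qed
  define K where "K = (\<chi> j. if act (blk j) \<and> j = J (blk j) then E $ blk j else 0)"
  have "(\<Sum>j | blk j = i. K $ j) = (if act i then E $ i else 0)" for i
  proof (cases "act i")
    case True
    have "(\<Sum>j | blk j = i. K $ j) = (\<Sum>j\<in>{J i}. K $ j)"
      by (rule sum.mono_neutral_right) (use J[OF True] in \<open>auto simp: K_def\<close>)
    with True J[OF True] show ?thesis by (simp add: K_def)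
  qed (auto simp: K_def intro!: sum.neutral)
  moreover have "0 \<le> K" using assms by (auto simp: K_def less_eq_vec_def)
  ultimately have "K \<in> feasible_gains blk E" by (auto simp: feasible_gains_def)
  moreover have "\<exists>j. blk j = i \<and> (\<forall>l. blk l = i \<longrightarrow> ?z $ j \<le> ?z $ l) \<and>
      K $ j = E $ i \<and> (\<forall>l. blk l = i \<and> l \<noteq> j \<longrightarrow> K $ l = 0)" if "act i" for i
    using J[OF that] that by (intro exI[of _ "J i"]) (auto simp: K_def)
  moreover have "\<forall>j. blk j = i \<longrightarrow> K $ j = 0" if "\<not> act i" for i
    using that by (auto simp: K_def)
  ultimately show ?thesis by (intro that[of K]) (auto simp: min_gain_def act_def)
qed

section \<open>The Bellman operator\<close>

lemma upart_vjoin [simp]: "upart (vjoin v u) = u"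
  by (simp add: upart_def vjoin_def vec_eq_iff)

text \<open>
  The right-hand side of the algebraic equation, with \<open>v v* A\<close> for \<open>transpose A *v v\<close>.
\<close>

definition bellman ::
  "('m::finite \<Rightarrow> 'n::finite) \<Rightarrow> real ^ 'n \<Rightarrow> real ^ 'm \<Rightarrow> real ^ 'n ^ 'n \<Rightarrow> real ^ 'm ^ 'n \<Rightarrow> real ^ 'n ^ 'n
     \<Rightarrow> real ^ 'n \<Rightarrow> real ^ 'n" where
  "bellman blk s r A B E v = s + v v* A + input_term blk E (r + v v* B)"

lemma model_solution_iff: "model_solution blk s r A B E p \<longleftrightarrow> bellman blk s r A B E p = p"
  by (auto simp: model_solution_def bellman_def input_term_def)

text \<open>
  For a fixed gain the right-hand side is the affine map of the closed loop. Through this form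
  the nonnegativity of \<open>A + B ** K\<close> becomes monotonicity, and minimizing over \<open>K\<close> gives
  concavity.
\<close>

lemma policy_cost_eq:
  fixes A :: "real ^ 'n ^ 'n" and B :: "real ^ 'm ^ 'n" and K :: "real ^ 'n ^ 'm"
  shows "s + v v* A + (r + v v* B) v* K = s + r v* K + v v* (A + B ** K)"
  by (simp add: vector_matrix_mult_add_rdistrib vector_matrix_left_distrib vector_matrix_mul_assoc algebra_simps)

lemma bellman_le_policy:
  assumes "K \<in> feasible_gains blk E" "0 \<le> E"
  shows "bellman blk s r A B E v \<le> s + r v* K + v v* (A + B ** K)"
  using input_term_le_gain[OF assms, of "r + v v* B"]
  by (simp add: bellman_def flip: policy_cost_eq)

lemma bellman_attained:
  assumes "0 \<le> E"
  obtains K where "K \<in> feasible_gains blk E" "bellman blk s r A B E v = s + r v* K + v v* (A + B ** K)"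
proof -
  \<comment> \<open>The minimizing gain depends only on the input part, so the state part \<open>0\<close> is a dummy.\<close>
  obtain K where K: "min_gain blk E (vjoin (0 :: real ^ 'a) (r + v v* B)) K"
    using min_gain_exists[OF assms] by blast
  show ?thesis
  proof (rule that)
    show "K \<in> feasible_gains blk E" using K by (simp add: min_gain_def)
    show "bellman blk s r A B E v = s + r v* K + v v* (A + B ** K)"
      using input_term_eq_min_gain[OF K] by (simp add: bellman_def flip: policy_cost_eq)
  qed
qed

text \<open>
  Every nonnegative state is reachable as an initial state, so the positivity assumption applies to
  the unit vectors and thus to each column.
\<close>

lemma closed_loop_nonneg:
  fixes A :: "real ^ 'n ^ 'n"
  assumes "positivity_assumption blk A B E" "K \<in> feasible_gains blk E"
  shows "0 \<le> A + B ** K"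
proof -
  have "0 \<le> (A + B ** K) *v axis j 1" for j
  proof -
    have "0 \<le> (axis j 1 :: real ^ 'n)" by (simp add: less_eq_vec_def axis_def)
    with assms reachable.init[OF this, of blk A B E] show ?thesis
      unfolding positivity_assumption_def by (elim ballE allE[of _ "axis j 1"]) auto
  qed
  then show ?thesis
    by (simp add: less_eq_vec_def matrix_vector_mul_component inner_axis)
qed

lemma vector_matrix_mult_mono:
  assumes "0 \<le> (M :: real ^ 'a ^ 'b)" "v \<le> w"
  shows "v v* M \<le> w v* M"
  using assms by (auto simp: less_eq_vec_def vector_matrix_mult_def intro!: sum_mono mult_right_mono)

text \<open>
  Use for \<open>v\<close> the gain that is optimal for \<open>w\<close>; it can only overestimate the value at \<open>v\<close>.
\<close>

lemma bellman_mono: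
  assumes "positivity_assumption blk A B E" "0 \<le> E" "v \<le> w"
  shows "bellman blk s r A B E v \<le> bellman blk s r A B E w"
proof -
  obtain K where K: "K \<in> feasible_gains blk E"
    "bellman blk s r A B E w = s + r v* K + w v* (A + B ** K)"
    using bellman_attained[OF assms(2)] .
  have "bellman blk s r A B E v \<le> s + r v* K + v v* (A + B ** K)"
    using bellman_le_policy[OF K(1) assms(2)] .
  also have "\<dots> \<le> bellman blk s r A B E w" unfolding K(2)
    by (intro add_left_mono vector_matrix_mult_mono closed_loop_nonneg[OF assms(1) K(1)] assms(3))
  finally show ?thesis .
qed

text \<open>
  Again one gain suffices, the one that is optimal at \<open>\<theta> v\<close>. Its affine map takes at \<open>0\<close> the
  value \<open>s + r v* K \<ge> s\<close>; here the nonnegative input cost enters.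
\<close>

lemma bellman_subhomogeneous:
  assumes "0 \<le> E" "0 \<le> r" "0 \<le> \<theta>" "\<theta> \<le> 1"
  shows "\<theta> *\<^sub>R bellman blk s r A B E v + (1 - \<theta>) *\<^sub>R s \<le> bellman blk s r A B E (\<theta> *\<^sub>R v)"
proof -
  obtain K where K: "K \<in> feasible_gains blk E"
    "bellman blk s r A B E (\<theta> *\<^sub>R v) = s + r v* K + (\<theta> *\<^sub>R v) v* (A + B ** K)"
    using bellman_attained[OF assms(1)] .
  let ?V = "v v* (A + B ** K)"
  have "0 \<le> r v* K"
    using vector_matrix_mult_mono[of K 0 r] K(1) assms(2) by (simp add: feasible_gains_def)
  then have "0 \<le> (1 - \<theta>) *\<^sub>R (r v* K)" using assms(4) by (simp add: scaleR_nonneg_nonneg)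
  moreover have "\<theta> *\<^sub>R bellman blk s r A B E v \<le> \<theta> *\<^sub>R (s + r v* K + ?V)"
    using bellman_le_policy[OF K(1) assms(1)] assms(3) by (rule scaleR_left_mono)
  ultimately have "\<theta> *\<^sub>R bellman blk s r A B E v + (1 - \<theta>) *\<^sub>R s
      \<le> \<theta> *\<^sub>R (s + r v* K + ?V) + (1 - \<theta>) *\<^sub>R s + (1 - \<theta>) *\<^sub>R (r v* K)"
    by (intro add_increasing2 add_right_mono)
  also have "\<dots> = s + r v* K + \<theta> *\<^sub>R ?V"
    by (simp add: scaleR_add_right scaleR_diff_left)
  also have "\<dots> = bellman blk s r A B E (\<theta> *\<^sub>R v)"
    unfolding K(2) by (simp only: scaleR_vector_matrix_assoc)
  finally show ?thesis .
qed

lemma subhomogeneous_map_bellman: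
  assumes "positivity_assumption blk A B E" "cost_assumption blk s r E" "0 \<le> E" "0 \<le> r"
  shows "subhomogeneous_map (bellman blk s r A B E) s"
proof
  have "0 \<le> r v* E_bar blk E"
    using vector_matrix_mult_mono[of "E_bar blk E" 0 r] assms(3,4)
    by (simp add: E_bar_def less_eq_vec_def)
  then have "0 \<le> (r v* E_bar blk E) $ i" for i by (simp add: less_eq_vec_def)
  moreover have "(r v* E_bar blk E) $ i < s $ i" for i
    using assms(2) by (simp add: cost_assumption_def)
  ultimately show "0 < s $ i" for i by (rule le_less_trans)
qed (rule bellman_mono[OF assms(1,3)] bellman_subhomogeneous[OF assms(3,4)]; assumption)+

section \<open>Dependence of the Bellman operator on the plant\<close>

lemma norm_inf_row_le: "(\<Sum>j\<in>UNIV. \<bar>M $ i $ j\<bar>) \<le> norm_inf M" for M :: "real ^ 'a ^ 'b"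
  unfolding norm_inf_def by (rule Max_ge) auto

lemma norm_inf_nonneg: "0 \<le> norm_inf M" for M :: "real ^ 'a ^ 'b"
  using norm_inf_row_le[of M undefined] by (auto intro: order_trans sum_nonneg)

lemma matrix_vector_mult_bound:
  fixes M :: "real ^ 'a ^ 'b"
  assumes "\<And>j. \<bar>v $ j\<bar> \<le> d"
  shows "\<bar>(M *v v) $ i\<bar> \<le> norm_inf M * d"
proof -
  have d: "0 \<le> d" using assms[of undefined] by linarith
  have "\<bar>(M *v v) $ i\<bar> \<le> (\<Sum>j\<in>UNIV. \<bar>M $ i $ j\<bar> * \<bar>v $ j\<bar>)"
    unfolding matrix_vector_mult_def by (simp flip: abs_mult)
  also have "\<dots> \<le> (\<Sum>j\<in>UNIV. \<bar>M $ i $ j\<bar> * d)" by (intro sum_mono mult_left_mono assms) auto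
  also have "\<dots> \<le> norm_inf M * d"
    unfolding sum_distrib_right[symmetric] by (intro mult_right_mono norm_inf_row_le d)
  finally show ?thesis .
qed

lemma input_term_diff_le:
  fixes blk :: "'m::finite \<Rightarrow> 'n::finite"
  assumes "\<And>j. \<bar>y $ j - z $ j\<bar> \<le> d" "0 \<le> d"
  shows "\<bar>input_term blk E y $ k - input_term blk E z $ k\<bar> \<le> norm_inf (transpose E) * d"
proof -
  let ?e = "\<chi> i. neg_min blk y i - neg_min blk z i"
  have "input_term blk E y $ k - input_term blk E z $ k = (transpose E *v ?e) $ k"
    by (simp add: input_term_def vector_matrix_mult_def sum_subtractf algebra_simps)
  also have "\<bar>\<dots>\<bar> \<le> norm_inf (transpose E) * d"
    by (rule matrix_vector_mult_bound) (use neg_min_diff_le[OF assms(2,1)] in simp)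
  finally show ?thesis .
qed

text \<open>
  An error in \<open>B\<close> changes each \<open>neg_min\<close> by at most as much as the entries of its argument, and
  these changes are then weighted by the rows of \<open>E\<close>. Hence the factor \<open>norm_inf (transpose E)\<close>
  belongs to the error in \<open>B\<close>.
\<close>

lemma bellman_diff_le:
  fixes blk :: "'m::finite \<Rightarrow> 'n::finite"
  assumes "norm_inf (transpose A - transpose A') + norm_inf (transpose E) * norm_inf (transpose B - transpose B') \<le> \<rho>"
    and "\<And>j. \<bar>v $ j\<bar> \<le> d"
  shows "\<bar>bellman blk s r A' B' E v $ i - bellman blk s r A B E v $ i\<bar> \<le> \<rho> * d"
proof -
  have d: "0 \<le> d" using assms(2)[of undefined] by linarith
  have A: "\<bar>(v v* A) $ i - (v v* A') $ i\<bar> \<le> norm_inf (transpose A - transpose A') * d"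
    using matrix_vector_mult_bound[OF assms(2), of "transpose A - transpose A'" i]
    by (simp add: matrix_vector_mult_diff_rdistrib)
  have B: "\<bar>(v v* B') $ j - (v v* B) $ j\<bar> \<le> norm_inf (transpose B - transpose B') * d" for j
    using matrix_vector_mult_bound[OF assms(2), of "transpose B - transpose B'" j]
    by (simp add: matrix_vector_mult_diff_rdistrib abs_minus_commute)
  have "\<bar>input_term blk E (r + v v* B') $ i - input_term blk E (r + v v* B) $ i\<bar>
      \<le> norm_inf (transpose E) * (norm_inf (transpose B - transpose B') * d)"
    by (rule input_term_diff_le) (use B mult_nonneg_nonneg[OF norm_inf_nonneg d] in auto)
  with A have "\<bar>bellman blk s r A' B' E v $ i - bellman blk s r A B E v $ i\<bar>
      \<le> (norm_inf (transpose A - transpose A') + norm_inf (transpose E) * norm_inf (transpose B - transpose B')) * d"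
    by (simp add: bellman_def algebra_simps)
  also have "\<dots> \<le> \<rho> * d" using assms(1) d by (rule mult_right_mono)
  finally show ?thesis .
qed

lemma continuous_on_bellman: "continuous_on UNIV (bellman blk s r A B E)"
proof -
  note lin = matrix_vector_mult_linear_continuous_on[of UNIV "transpose A", simplified]
    matrix_vector_mult_linear_continuous_on[of UNIV "transpose B", simplified]
  have "continuous_on UNIV (\<lambda>v. neg_min blk (r + v v* B) i)" for i
    by (rule continuous_on_compose2[OF continuous_on_neg_min[of blk i], of UNIV "\<lambda>v. r + v v* B"])
      (auto intro!: continuous_intros lin)
  then show ?thesis unfolding bellman_def input_term_def
    by (intro continuous_intros lin)
qed

section \<open>The data-based equation as an estimated model equation\<close>

lemma quadratic_form_outer: "v \<bullet> (outer y y *v v) = (y \<bullet> v)\<^sup>2"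
proof -
  have "outer y y *v v = (y \<bullet> v) *\<^sub>R y"
    by (simp add: vec_eq_iff outer_def matrix_vector_mult_def inner_vec_def sum_distrib_left mult_ac)
  then show ?thesis by (simp add: power2_eq_square inner_commute)
qed

lemma pos_def_Sigma_mat:
  assumes "pos_def S0" "0 < l"
  shows "pos_def (Sigma_mat l S0 x u t)"
proof -
  let ?y = "\<lambda>k. vjoin (x k) (u k)"
  have "transpose (Sigma_mat l S0 x u t) = Sigma_mat l S0 x u t"
    using assms(1) by (simp add: pos_def_def Sigma_mat_def transpose_def outer_def vec_eq_iff mult.commute)
  moreover have "v \<bullet> (Sigma_mat l S0 x u t *v v) > 0" if "v \<noteq> 0" for v
  proof -
    have "linear (\<lambda>M. v \<bullet> (M *v v))"
      by (rule linearI) (simp_all add: matrix_vector_mult_add_rdistrib inner_add_right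
          flip: scaleR_matrix_vector_assoc)
    note lin = linear_sum[OF this] linear_add[OF this] linear_scale[OF this]
    have "v \<bullet> (Sigma_mat l S0 x u t *v v) =
        (\<Sum>k<t. l ^ (t - 1 - k) * (?y k \<bullet> v)\<^sup>2) + l ^ t * (v \<bullet> (S0 *v v))"
      by (simp add: Sigma_mat_def lin quadratic_form_outer)
    moreover have "0 \<le> (\<Sum>k<t. l ^ (t - 1 - k) * (?y k \<bullet> v)\<^sup>2)"
      using assms(2) by (intro sum_nonneg) simp
    moreover have "0 < l ^ t * (v \<bullet> (S0 *v v))"
      using assms that by (simp add: pos_def_def)
    ultimately show ?thesis by linarith
  qed
  ultimately show ?thesis by (simp add: pos_def_def)
qed

lemma pos_def_matrix_inv:
  assumes "pos_def S"
  shows "S ** matrix_inv S = mat 1" "matrix_inv S ** S = mat 1"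
proof -
  have "v = 0" if "S *v v = 0" for v
    using assms that unfolding pos_def_def by (metis inner_zero_right less_irrefl)
  then have "\<exists>A'. S ** A' = mat 1 \<and> A' ** S = mat 1"
    using matrix_left_invertible_ker[of S] invertible_left_inverse[of S]
    by (auto simp: invertible_def)
  then have "S ** matrix_inv S = mat 1 \<and> matrix_inv S ** S = mat 1"
    unfolding matrix_inv_def by (rule someI_ex)
  then show "S ** matrix_inv S = mat 1" "matrix_inv S ** S = mat 1" by auto
qed

lemma hstack_mult:
  "hstack M N *v q = M *v (\<chi> i. q $ Inl i) + N *v upart q"
  for M :: "real ^ 'a ^ 'c" and N :: "real ^ 'b ^ 'c"
  by (simp add: vec_eq_iff hstack_def vjoin_def upart_def matrix_vector_mult_def
      sum.Plus flip: UNIV_Plus_UNIV)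

lemma vector_mult_vstack: "q v* vstack (mat 1) K = hstack (mat 1) (transpose K) *v q"
  by (simp add: hstack_mult)
    (simp add: vec_eq_iff vstack_def upart_def vector_matrix_mult_def mat_def
      sum.Plus if_distrib cong: if_cong flip: UNIV_Plus_UNIV)

text \<open>
  Solving for \<open>q\<close>: the right-hand side of the data-based equation sees \<open>q\<close> only through
  \<open>p = [I K\<^sup>T] q\<close>, so that \<open>q\<close> is an explicit affine function of \<open>p\<close>.
\<close>

lemma data_solution_iff:
  assumes "pos_def S"
  shows "data_solution blk s r E S Sb q K \<longleftrightarrow> min_gain blk E q K \<and>
    q = vjoin s r + (matrix_inv S ** transpose Sb) *v (hstack (mat 1) (transpose K) *v q)"
proof -
  let ?p = "hstack (mat 1) (transpose K) *v q"
  have sym: "y v* S = S *v y" for y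
    using assms transpose_matrix_vector[of S y] by (simp add: pos_def_def)
  have "(q - vjoin s r) v* S = q v* vstack (mat 1) K v* Sb \<longleftrightarrow> S *v (q - vjoin s r) = transpose Sb *v ?p"
    by (simp add: vector_mult_vstack sym)
  also have "\<dots> \<longleftrightarrow> q - vjoin s r = matrix_inv S *v (transpose Sb *v ?p)"
    using pos_def_matrix_inv[OF assms]
    by (metis matrix_vector_mul_assoc matrix_vector_mul_lid)
  also have "\<dots> \<longleftrightarrow> q = vjoin s r + (matrix_inv S ** transpose Sb) *v ?p"
    unfolding matrix_vector_mul_assoc[of "matrix_inv S"] by (metis add_diff_cancel_left' diff_add_cancel add.commute)
  finally show ?thesis by (simp add: data_solution_def)
qed

text \<open>
  The value is a function of \<open>q\<close> alone; ties between minimizing gains do not matter.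
\<close>

lemma min_gain_value:
  assumes "min_gain blk E q K"
  shows "hstack (mat 1) (transpose K) *v q = (\<chi> i. q $ Inl i) + input_term blk E (upart q)"
  using input_term_eq_min_gain[OF assms] by (simp add: hstack_mult)

locale data_model =
  fixes blk :: "'m::finite \<Rightarrow> 'n::finite" and s :: "real ^ 'n" and r :: "real ^ 'm" and E :: "real ^ 'n ^ 'n"
    and S :: "real ^ ('n + 'm) ^ ('n + 'm)" and Sb :: "real ^ ('n + 'm) ^ 'n"
  assumes pos_def: "pos_def S" and E_nonneg: "0 \<le> E"
begin

definition "A_est = transpose (hstack (mat 1) 0 ** matrix_inv S ** transpose Sb)"
definition "B_est = transpose (hstack 0 (mat 1) ** matrix_inv S ** transpose Sb)"

text \<open>
  As a linear form in state and input, \<open>q\<close> is the stage cost plus the form \<open>v\<close> at the next state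
  that the estimated model predicts; so the data-based equation is a Bellman equation.
\<close>

lemma parts_of_data_vector:
  assumes "q = vjoin s r + (matrix_inv S ** transpose Sb) *v v"
  shows "(\<chi> i. q $ Inl i) = s + v v* A_est" "upart q = r + v v* B_est"
proof -
  have T: "H *v q = H *v vjoin s r + v v* transpose (H ** matrix_inv S ** transpose Sb)"
    for H :: "real ^ ('n + 'm) ^ 'k"
    unfolding assms by (simp add: matrix_vector_right_distrib matrix_vector_mul_assoc matrix_mul_assoc)
  have x: "(\<chi> i. y $ Inl i) = hstack (mat 1) 0 *v y" for y :: "real ^ ('n + 'm)"
    by (simp add: hstack_mult)
  have u: "upart y = hstack 0 (mat 1) *v y" for y :: "real ^ ('n + 'm)"
    by (simp add: hstack_mult)
  have xs: "hstack (mat 1) 0 *v vjoin s r = s"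
    unfolding x[symmetric] by (simp add: vjoin_def vec_eq_iff)
  show "(\<chi> i. q $ Inl i) = s + v v* A_est"
    by (simp only: x[of q] T A_est_def xs)
  show "upart q = r + v v* B_est"
    by (simp only: u[of q] T B_est_def u[symmetric] upart_vjoin)
qed

lemma data_solution_fixed_point:
  assumes "data_solution blk s r E S Sb q K"
  shows "bellman blk s r A_est B_est E (hstack (mat 1) (transpose K) *v q) = hstack (mat 1) (transpose K) *v q"
proof -
  have "min_gain blk E q K"
    and "q = vjoin s r + (matrix_inv S ** transpose Sb) *v (hstack (mat 1) (transpose K) *v q)"
    using assms data_solution_iff[OF pos_def] by blast+
  from min_gain_value[OF this(1)] parts_of_data_vector[OF this(2)] show ?thesis
    by (simp add: bellman_def)
qed

lemma fixed_point_data_solution: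
  assumes "bellman blk s r A_est B_est E v = v"
  obtains q K where "data_solution blk s r E S Sb q K" "hstack (mat 1) (transpose K) *v q = v"
proof -
  define q where "q = vjoin s r + (matrix_inv S ** transpose Sb) *v v"
  obtain K where K: "min_gain blk E q K" using min_gain_exists[OF E_nonneg] .
  have "hstack (mat 1) (transpose K) *v q = v"
    using min_gain_value[OF K] parts_of_data_vector[OF q_def] assms by (simp add: bellman_def)
  with K show ?thesis
    by (intro that[of q K]) (auto simp: data_solution_iff[OF pos_def] q_def)
qed

lemma data_solution_value_eq:
  assumes "data_solution blk s r E S Sb q K" "data_solution blk s r E S Sb q K'"
  shows "hstack (mat 1) (transpose K) *v q = hstack (mat 1) (transpose K') *v q"
  using assms min_gain_value by (metis data_solution_def)

end

section \<open>Comparison of the two solutions\<close>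

text \<open>
  The comparison at one time, for arbitrary correlation matrices \<open>S\<close> and \<open>Sb\<close>: how the data were
  generated enters only through the estimation error.
\<close>

lemma data_value_bounds:
  fixes blk :: "'m::finite \<Rightarrow> 'n::finite"
    and A E :: "real ^ 'n ^ 'n" and B :: "real ^ 'm ^ 'n"
    and S :: "real ^ ('n + 'm) ^ ('n + 'm)" and Sb :: "real ^ ('n + 'm) ^ 'n"
  assumes r: "0 \<le> r" and E: "0 \<le> E" and \<beta>: "0 \<le> \<beta>" and \<rho>: "0 \<le> \<rho>" "\<rho> * \<beta> < 1"
    and S: "pos_def S" and plant: "(A, B, E) \<in> plant_class blk s r \<beta>"
    and err: "norm_inf (transpose A - hstack (mat 1) 0 ** matrix_inv S ** transpose Sb)
           + norm_inf (transpose E) *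
             norm_inf (transpose B - hstack 0 (mat 1) ** matrix_inv S ** transpose Sb) \<le> \<rho>"
    and p: "0 \<le> p" "model_solution blk s r A B E p"
    and q: "data_solution blk s r E S Sb q K"
    and side: "0 \<le> hstack (mat 1) (transpose K) *v q \<or>
           0 < 1 - inverse (1 - \<rho> * \<beta>) * (\<rho> * \<beta>) \<and>
           (\<forall>q' K'. data_solution blk s r E S Sb q' K' \<longrightarrow> q' = q)"
  shows "(1 - inverse (1 - \<rho> * \<beta>) * (\<rho> * \<beta>)) *\<^sub>R p \<le> hstack (mat 1) (transpose K) *v q"
    and "hstack (mat 1) (transpose K) *v q \<le> inverse (1 - \<rho> * \<beta>) *\<^sub>R p"
proof -
  let ?F = "bellman blk s r A B E" and ?p = "hstack (mat 1) (transpose K) *v q"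
  let ?c = "\<beta> * Min (range (($) s))"
  interpret data_model blk s r E S Sb using S E by unfold_locales
  let ?G = "bellman blk s r A_est B_est E"
  obtain p' where p': "model_solution blk s r A B E p'" "s \<le> p'" "p' \<le> ?c *\<^sub>R 1"
    and pos: "positivity_assumption blk A B E" "cost_assumption blk s r E"
    using plant unfolding plant_class_def by auto
  interpret subhomogeneous_map ?F s
    using subhomogeneous_map_bellman[OF pos E r] .
  have "0 \<le> p'"
    using s_pos by (intro order_trans[OF _ p'(2)]) (simp add: less_eq_vec_def less_imp_le)
  \<comment> \<open>The bound from the plant class, stated for \<open>p'\<close>, carries over to the given solution.\<close>
  then have "p \<le> p'"
    using nonneg_fixed_points_le[of p' p] p p'(1) by (simp add: model_solution_iff)
  then have p_le: "p $ i \<le> ?c" for i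
    using p'(3) by (auto simp: less_eq_vec_def intro: order_trans)
  interpret perturbed_fixed_point ?F s ?G p \<rho> ?c "\<rho> * \<beta>"
  proof
    show "?F p = p" using p(2) by (simp add: model_solution_iff)
    show "\<bar>?G v $ i - ?F v $ i\<bar> \<le> \<rho> * d" if "0 \<le> v" "\<And>j. v $ j \<le> d" for v d i
    proof (rule bellman_diff_le)
      show "\<bar>v $ j\<bar> \<le> d" for j using that by (simp add: less_eq_vec_def)
      show "norm_inf (transpose A - transpose A_est)
          + norm_inf (transpose E) * norm_inf (transpose B - transpose B_est) \<le> \<rho>"
        using err by (simp add: A_est_def B_est_def)
    qed
    show "\<rho> * ?c \<le> \<rho> * \<beta> * s $ i" for i
      unfolding mult.assoc using \<beta> \<rho> by (intro mult_left_mono Min_le) auto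
  qed (use p(1) \<rho> p_le in auto)
  have "0 \<le> ?p"
  proof (rule ccontr)
    assume "\<not> 0 \<le> ?p"
    with side have pos: "0 < 1 - inverse (1 - \<rho> * \<beta>) * (\<rho> * \<beta>)"
      and uniq: "\<And>q' K'. data_solution blk s r E S Sb q' K' \<Longrightarrow> q' = q" by auto
    obtain v where v: "0 \<le> v" "?G v = v"
      using perturbed_fixed_point_exists[OF continuous_on_bellman] pos by auto
    obtain q' K' where q': "data_solution blk s r E S Sb q' K'" "hstack (mat 1) (transpose K') *v q' = v"
      using fixed_point_data_solution[OF v(2)] .
    with uniq have "q' = q" by blast
    with q' q data_solution_value_eq have "?p = v" by metis
    with v(1) \<open>\<not> 0 \<le> ?p\<close> show False by simp
  qed
  with data_solution_fixed_point[OF q]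
  show "(1 - inverse (1 - \<rho> * \<beta>) * (\<rho> * \<beta>)) *\<^sub>R p \<le> ?p" "?p \<le> inverse (1 - \<rho> * \<beta>) *\<^sub>R p"
    by (auto intro: perturbed_fixed_point_ge perturbed_fixed_point_le)
qed

theorem theorem1:
  fixes blk :: "'m::finite \<Rightarrow> 'n::finite"
    and A E :: "real ^ 'n ^ 'n" and B :: "real ^ 'm ^ 'n"
    and s p :: "real ^ 'n" and r :: "real ^ 'm"
    and \<beta> \<rho> l \<alpha>_hat \<alpha>_check :: real
    and x w :: "nat \<Rightarrow> real ^ 'n" and u :: "nat \<Rightarrow> real ^ 'm"
    and \<Sigma>0 :: "real ^ ('n + 'm) ^ ('n + 'm)"
    and q :: "nat \<Rightarrow> real ^ ('n + 'm)" and K :: "nat \<Rightarrow> real ^ 'n ^ 'm"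
    and t0 :: nat
  assumes "0 \<le> s" and "0 \<le> r" and "0 \<le> E"
    and "0 \<le> \<beta>" and "0 \<le> \<rho>" and "\<rho> * \<beta> < 1"
    and "0 < l" and "l \<le> 1" and "pos_def \<Sigma>0"
    and "\<And>k. x (k + 1) = A *v x k + B *v u k + w k"
    and "(A, B, E) \<in> plant_class blk s r \<beta>"
    and "\<And>t. t \<ge> t0 \<Longrightarrow>
           norm_inf (transpose A - hstack (mat 1) 0 ** matrix_inv (Sigma_mat l \<Sigma>0 x u t) ** transpose (Sigma_bar l x u t))
           + norm_inf (transpose E) *
             norm_inf (transpose B - hstack 0 (mat 1) ** matrix_inv (Sigma_mat l \<Sigma>0 x u t) ** transpose (Sigma_bar l x u t))
           \<le> \<rho>"
    and "0 \<le> p" and "model_solution blk s r A B E p"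
    and "\<And>t. t \<ge> t0 \<Longrightarrow> data_solution blk s r E (Sigma_mat l \<Sigma>0 x u t) (Sigma_bar l x u t) (q t) (K t)"
    and "\<And>t. t \<ge> t0 \<Longrightarrow>
           0 \<le> hstack (mat 1) (transpose (K t)) *v q t \<or>
           0 < \<alpha>_hat \<and>
           (\<forall>q' K'. data_solution blk s r E (Sigma_mat l \<Sigma>0 x u t) (Sigma_bar l x u t) q' K' \<longrightarrow> q' = q t)"
    and "\<alpha>_check = 1 - \<rho> * \<beta>" and "\<alpha>_hat = 1 - inverse \<alpha>_check * \<rho> * \<beta>"
  shows "0 < \<alpha>_check \<and> (0 < \<alpha>_hat \<longleftrightarrow> 2 * (\<rho> * \<beta>) < 1) \<and>
         (\<forall>t\<ge>t0. \<alpha>_hat *\<^sub>R p \<le> hstack (mat 1) (transpose (K t)) *v q t \<and>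
                  hstack (mat 1) (transpose (K t)) *v q t \<le> inverse \<alpha>_check *\<^sub>R p)"
proof (intro conjI allI impI)
  show "0 < \<alpha>_check" using assms(6,17) by simp
  then show "0 < \<alpha>_hat \<longleftrightarrow> 2 * (\<rho> * \<beta>) < 1"
    by (simp add: assms(17,18) field_simps)
  fix t assume t: "t0 \<le> t"
  have \<alpha>: "\<alpha>_check = 1 - \<rho> * \<beta>" "\<alpha>_hat = 1 - inverse (1 - \<rho> * \<beta>) * (\<rho> * \<beta>)"
    using assms(17,18) by (simp_all add: mult.assoc)
  note bounds = data_value_bounds[OF assms(2-6) pos_def_Sigma_mat[OF assms(9,7)] assms(11)
      assms(12)[OF t] assms(13,14) assms(15)[OF t] assms(16)[OF t, unfolded \<alpha>]]
  show "\<alpha>_hat *\<^sub>R p \<le> hstack (mat 1) (transpose (K t)) *v q t"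
    unfolding \<alpha> by (rule bounds(1))
  show "hstack (mat 1) (transpose (K t)) *v q t \<le> inverse \<alpha>_check *\<^sub>R p"
    unfolding \<alpha> by (rule bounds(2))
qed

end
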